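(* Let $\mathcal{P}$ be a finite set of points in $\mathbb{R}^d$ and let $\textsf{minPts}\leq 3$ be a positive integer. Then every Euclidean minimum spanning tree of $\mathcal{P}$ is a minimum spanning tree of the mutual reachability graph $G_{MR}$ of $\mathcal{P}$.
   Context: $d(p,q)$ is the Euclidean distance. A Euclidean minimum spanning tree of $\mathcal{P}$ is a minimum spanning tree of the complete graph on $\mathcal{P}$ with edge weights $d(p,q)$. The core distance $\textsf{cd}(p)$ of $p\in\mathcal{P}$ is the distance from $p$ to its $\textsf{minPts}$-nearest neighbor in $\mathcal{P}$, where $p$ itself counts as its own first nearest neighbor. The mutual reachability distance is $d_m(p,q)=\max\{\textsf{cd}(p),\textsf{cd}(q),d(p,q)\}$, and $G_{MR}$ is the complete undirected graph on $\mathcal{P}$ with edge weights $d_m$. *)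

theory Defs
  imports "HOL-Analysis.Analysis" "HOL-Library.Multiset"
begin

text \<open>
  Undirected simple graphs: an edge is a two-element set of vertices, and a spanning subgraph
  is given by its edge set. (The predicates \<open>forest\<close> and \<open>tree\<close> of the AFP entry
  \<open>Graph_Theory\<close> refer to directed cycles and are therefore not suitable here: a symmetric
  digraph with at least one arc is never a forest in that sense.)
\<close>

record 'a weighted_graph =
  verts :: "'a set"
  edges :: "'a set set"
  weight :: "'a set \<Rightarrow> real"

definition adj :: "'a set set \<Rightarrow> ('a \<times> 'a) set" where
  "adj F = {(u, v). {u, v} \<in> F}"

definition connected_on :: "'a set \<Rightarrow> 'a set set \<Rightarrow> bool" where
  "connected_on V F \<longleftrightarrow> (\<forall>u\<in>V. \<forall>v\<in>V. (u, v) \<in> (adj F)\<^sup>*)"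

text \<open>A cycle is listed by its vertices, without repeating the first one at the end.\<close>

definition is_cycle :: "'a set set \<Rightarrow> 'a list \<Rightarrow> bool" where
  "is_cycle F c \<longleftrightarrow> 3 \<le> length c \<and> distinct c \<and>
     (\<forall>i<length c. {c ! i, c ! (Suc i mod length c)} \<in> F)"

definition spanning_tree :: "'a weighted_graph \<Rightarrow> 'a set set \<Rightarrow> bool" where
  "spanning_tree G T \<longleftrightarrow> T \<subseteq> edges G \<and> connected_on (verts G) T \<and> (\<nexists>c. is_cycle T c)"

definition minimum_spanning_tree :: "'a weighted_graph \<Rightarrow> 'a set set \<Rightarrow> bool" where
  "minimum_spanning_tree G T \<longleftrightarrow> spanning_tree G T \<and>
     (\<forall>T'. spanning_tree G T' \<longrightarrow> (\<Sum>e\<in>T. weight G e) \<le> (\<Sum>e\<in>T'. weight G e))"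

text \<open>
  A function \<open>w\<close> that is symmetric in its two arguments, read as a function on edges; see
  \<open>edge_weight_doubleton\<close> below.
\<close>

definition edge_weight :: "('a \<Rightarrow> 'a \<Rightarrow> real) \<Rightarrow> 'a set \<Rightarrow> real" where
  "edge_weight w e = (THE c. \<exists>p q. e = {p, q} \<and> c = w p q)"

lemma edge_weight_doubleton:
  assumes "p \<noteq> q" and "w q p = w p q"
  shows "edge_weight w {p, q} = w p q"
  unfolding edge_weight_def using assms by (intro the_equality) (auto simp: doubleton_eq_iff)

definition complete_graph :: "'a set \<Rightarrow> ('a \<Rightarrow> 'a \<Rightarrow> real) \<Rightarrow> 'a weighted_graph" where
  "complete_graph P w =
     \<lparr>verts = P, edges = {{p, q} | p q. p \<in> P \<and> q \<in> P \<and> p \<noteq> q}, weight = edge_weight w\<rparr>"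

text \<open>
  The distances from \<open>p\<close> to the points of \<open>P\<close>, listed in nondecreasing order with
  multiplicity; for \<open>p \<in> P\<close> the first entry is the distance from \<open>p\<close> to itself, and the entry
  at position \<open>k - 1\<close> (counting from 0) belongs to a \<open>k\<close>-nearest neighbor, however ties are
  broken. The value is meaningful only for \<open>1 \<le> k \<le> card P\<close>; outside this range it is
  unspecified.
\<close>

definition core_distance :: "nat \<Rightarrow> 'a::metric_space set \<Rightarrow> 'a \<Rightarrow> real" where
  "core_distance k P p = sorted_list_of_multiset (image_mset (dist p) (mset_set P)) ! (k - 1)"

lemma core_distance_1:
  assumes "finite P" and "p \<in> P"
  shows "core_distance 1 P p = 0"
proof -
  define L where "L = sorted_list_of_multiset (image_mset (dist p) (mset_set P))"
  have s: "set L = dist p ` P" and L: "sorted L" using assms by (simp_all add: L_def)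
  have "0 \<in> set L" using assms(2) unfolding s by (force simp: image_iff)
  then obtain i where i: "i < length L" "L ! i = 0" by (auto simp: in_set_conv_nth)
  have "L ! 0 \<le> L ! i" using i L by (intro sorted_nth_mono) auto
  moreover have "L ! 0 \<in> dist p ` P"
    using i(1) s nth_mem[of 0 L] by (metis gr_implies_not0 neq0_conv)
  ultimately show ?thesis using i by (auto simp: core_distance_def L_def)
qed

definition mutual_reachability :: "nat \<Rightarrow> 'a::metric_space set \<Rightarrow> 'a \<Rightarrow> 'a \<Rightarrow> real" where
  "mutual_reachability k P p q = Max {core_distance k P p, core_distance k P q, dist p q}"

lemma mutual_reachability_commute:
  "mutual_reachability k P q p = mutual_reachability k P p q"
  by (simp add: mutual_reachability_def insert_commute dist_commute)

definition mutual_reachability_graph :: "nat \<Rightarrow> 'a::metric_space set \<Rightarrow> 'a weighted_graph" where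
  "mutual_reachability_graph k P = complete_graph P (mutual_reachability k P)"

definition euclidean_mst :: "'a::euclidean_space set \<Rightarrow> 'a set set \<Rightarrow> bool" where
  "euclidean_mst P T \<longleftrightarrow> minimum_spanning_tree (complete_graph P dist) T"

end

theory Submission
  imports Defs
begin

text \<open>
  A spanning tree is minimum iff no edge \<open>{u, v}\<close> of the graph is lighter than an edge of the
  tree path from \<open>u\<close> to \<open>v\<close>. Let this hold for the Euclidean distance, and let \<open>x\<close> be a vertex
  of such a path. If \<open>x\<close> is an end of the path, its core distance is at most \<open>d\<^sub>m(u, v)\<close> by
  definition. Otherwise the two path neighbors of \<open>x\<close> and \<open>x\<close> itself are three points within
  distance \<open>d(u, v)\<close> of \<open>x\<close>, so its core distance is at most \<open>d(u, v)\<close> because \<open>minPts \<le> 3\<close>.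
  Hence the criterion carries over to the mutual reachability distance.
\<close>

section \<open>Paths, reachability and bridges\<close>

definition distinct_path :: "'a set set \<Rightarrow> 'a list \<Rightarrow> bool" where
  "distinct_path F xs \<longleftrightarrow> xs \<noteq> [] \<and> distinct xs \<and> (\<forall>i. Suc i < length xs \<longrightarrow> {xs ! i, xs ! Suc i} \<in> F)"

lemma adj_iff: "(u, v) \<in> adj F \<longleftrightarrow> {u, v} \<in> F"
  by (simp add: adj_def)

lemma adj_rtrancl_sym: "(u, v) \<in> (adj F)\<^sup>* \<Longrightarrow> (v, u) \<in> (adj F)\<^sup>*"
proof -
  have "sym (adj F)"
    by (auto simp: sym_def adj_def insert_commute)
  then show "(u, v) \<in> (adj F)\<^sup>* \<Longrightarrow> (v, u) \<in> (adj F)\<^sup>*"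
    by (meson sym_rtrancl symD)
qed

lemma adj_rtrancl_mono: "F \<subseteq> F' \<Longrightarrow> (u, v) \<in> (adj F)\<^sup>* \<Longrightarrow> (u, v) \<in> (adj F')\<^sup>*"
  by (rule subsetD[OF rtrancl_mono]) (auto simp: adj_def)

text \<open>Edges are required only between positions \<open>i\<close> and \<open>j\<close>, so a
  stretch of a path or cycle can be used after an edge outside that stretch has been removed from
  \<open>F\<close>.\<close>

lemma walk_rtrancl:
  assumes "i \<le> j" and "\<And>k. i \<le> k \<Longrightarrow> k < j \<Longrightarrow> {xs ! k, xs ! Suc k} \<in> F"
  shows "(xs ! i, xs ! j) \<in> (adj F)\<^sup>*"
  using assms
proof (induction rule: dec_induct)
  case (step n)
  then have "(xs ! i, xs ! n) \<in> (adj F)\<^sup>*" "(xs ! n, xs ! Suc n) \<in> adj F"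
    by (auto simp: adj_iff)
  then show ?case by (rule rtrancl_into_rtrancl)
qed simp

lemma distinct_path_edge_eqD:
  assumes "distinct_path F xs" "Suc i < length xs" "Suc j < length xs"
    and "{xs ! i, xs ! Suc i} = {xs ! j, xs ! Suc j}"
  shows "i = j"
  using assms by (auto simp: distinct_path_def doubleton_eq_iff nth_eq_iff_index_eq)

text \<open>The walk is built from its end by prepending vertices. If the new vertex already lies on
  the path, the part before it is cut off instead, which keeps the vertices distinct.\<close>

lemma rtrancl_obtains_distinct_path:
  assumes "(u, v) \<in> (adj F)\<^sup>*"
  obtains xs where "distinct_path F xs" "hd xs = u" "last xs = v"
proof -
  from assms have "\<exists>xs. distinct_path F xs \<and> hd xs = u \<and> last xs = v"
  proof (induction rule: converse_rtrancl_induct)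
    case base
    have "distinct_path F [v]" by (simp add: distinct_path_def)
    then show ?case by force
  next
    case (step y z)
    then obtain xs where xs: "distinct_path F xs" "hd xs = z" "last xs = v" by blast
    show ?case
    proof (cases "y \<in> set xs")
      case True
      then obtain i where i: "i < length xs" "xs ! i = y" by (auto simp: in_set_conv_nth)
      have "distinct_path F (drop i xs)"
        using xs(1) i by (auto simp: distinct_path_def)
      then show ?thesis using i xs(3) by (intro exI[of _ "drop i xs"]) (auto simp: hd_drop_conv_nth)
    next
      case False
      have "distinct_path F (y # xs)"
        using xs step(1) False
        by (auto simp: distinct_path_def adj_iff nth_Cons hd_conv_nth split: nat.split)
      then show ?thesis using xs by (intro exI[of _ "y # xs"]) (auto simp: distinct_path_def)
    qed
  qed
  then show ?thesis using that by blast
qed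

lemma distinct_path_closing_edge_is_cycle:
  assumes "distinct_path F xs" "3 \<le> length xs" "{last xs, hd xs} \<in> F"
  shows "is_cycle F xs"
  unfolding is_cycle_def
proof (intro conjI allI impI)
  fix i assume i: "i < length xs"
  show "{xs ! i, xs ! (Suc i mod length xs)} \<in> F"
  proof (cases "Suc i = length xs")
    case True
    moreover from True have "xs \<noteq> []" by auto
    ultimately have "last xs = xs ! i" "hd xs = xs ! 0"
      by (simp_all add: last_conv_nth hd_conv_nth flip: True)
    then show ?thesis using True assms(3) by simp
  next
    case False
    then show ?thesis using assms(1) i by (simp add: distinct_path_def)
  qed
qed (use assms in \<open>auto simp: distinct_path_def\<close>)

text \<open>A path that joins the ends of an edge while avoiding it closes to a cycle, and a cycle
  without its closing edge is such a path. Loops must be excluded: a loop violates the right-hand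
  side, since \<open>x\<close> always reaches itself, but it forms no cycle in the sense of
  \<open>is_cycle\<close>.\<close>

lemma acyclic_iff_bridges:
  assumes "\<And>x. {x} \<notin> F"
  shows "(\<nexists>c. is_cycle F c) \<longleftrightarrow> (\<forall>x y. {x, y} \<in> F \<longrightarrow> (x, y) \<notin> (adj (F - {{x, y}}))\<^sup>*)"
proof (intro iffI allI impI notI)
  fix x y assume no: "\<nexists>c. is_cycle F c" and e: "{x, y} \<in> F" and "(x, y) \<in> (adj (F - {{x, y}}))\<^sup>*"
  then obtain xs where xs: "distinct_path (F - {{x, y}}) xs" "hd xs = x" "last xs = y"
    by (blast elim: rtrancl_obtains_distinct_path)
  have "x \<noteq> y" using e assms by fastforce
  then have "length xs \<noteq> 0" "length xs \<noteq> 1"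
    using xs by (auto simp: distinct_path_def length_Suc_conv)
  \<comment> \<open>A path with two vertices would consist of the removed edge itself.\<close>
  moreover have "length xs \<noteq> 2"
    using xs by (auto simp: distinct_path_def numeral_2_eq_2 length_Suc_conv)
  ultimately have "3 \<le> length xs" by linarith
  moreover have "distinct_path F xs" using xs(1) by (auto simp: distinct_path_def)
  moreover have "{last xs, hd xs} \<in> F" using xs e by (simp add: insert_commute)
  ultimately show False using no distinct_path_closing_edge_is_cycle by blast
next
  assume br: "\<forall>x y. {x, y} \<in> F \<longrightarrow> (x, y) \<notin> (adj (F - {{x, y}}))\<^sup>*" and "\<exists>c. is_cycle F c"
  then obtain c where c: "is_cycle F c" by blast
  define n where "n = length c - 1"
  have n: "length c = Suc n" "2 \<le> n" and d: "distinct c"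
    using c by (auto simp: is_cycle_def n_def)
  \<comment> \<open>At the last index \<open>n\<close> the successor modulo the length wraps around
    to 0.\<close>
  have closing: "{c ! 0, c ! n} \<in> F"
    using c n by (auto simp: is_cycle_def insert_commute dest: spec[of _ n])
  have "(c ! 0, c ! n) \<in> (adj (F - {{c ! 0, c ! n}}))\<^sup>*"
  proof (rule walk_rtrancl)
    fix k assume k: "k < n"
    have "Suc k mod length c = Suc k" using k n by simp
    then have "{c ! k, c ! Suc k} \<in> F"
      using c k n unfolding is_cycle_def by (metis less_SucI)
    \<comment> \<open>Here \<open>2 \<le> n\<close> matters: with only two vertices the closing edge
      would coincide with the edge at \<open>k = 0\<close>.\<close>
    moreover have "{c ! k, c ! Suc k} \<noteq> {c ! 0, c ! n}"
      using d n k by (auto simp: doubleton_eq_iff nth_eq_iff_index_eq)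
    ultimately show "{c ! k, c ! Suc k} \<in> F - {{c ! 0, c ! n}}" by simp
  qed simp
  with br closing show False by blast
qed

text \<open>Only the direction of the net crossing of the new edge matters: crossing in one
  direction and later in the other returns the walk to a vertex that \<open>a\<close> already
  reaches within \<open>F\<close>.\<close>

lemma rtrancl_adj_insertE:
  assumes "(a, b) \<in> (adj (insert {x, y} F))\<^sup>*"
  obtains "(a, b) \<in> (adj F)\<^sup>*"
    | "(a, x) \<in> (adj F)\<^sup>*" "(y, b) \<in> (adj F)\<^sup>*"
    | "(a, y) \<in> (adj F)\<^sup>*" "(x, b) \<in> (adj F)\<^sup>*"
proof -
  from assms have "(a, b) \<in> (adj F)\<^sup>* \<or> (a, x) \<in> (adj F)\<^sup>* \<and> (y, b) \<in> (adj F)\<^sup>* \<or>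
      (a, y) \<in> (adj F)\<^sup>* \<and> (x, b) \<in> (adj F)\<^sup>*"
  proof (induction rule: rtrancl_induct)
    case (step b c)
    consider "(b, c) \<in> adj F" | "b = x" "c = y" | "b = y" "c = x"
      using step(2) by (auto simp: adj_iff doubleton_eq_iff)
    then show ?case
      using step.IH by cases (blast intro: rtrancl_into_rtrancl)+
  qed simp
  then show ?thesis using that by blast
qed

section \<open>Spanning trees and the exchange of edges\<close>

text \<open>The record type alone allows loops and edges that leave the vertex set. Finiteness keeps
  sums of weights from taking the default value 0 of infinite sums.\<close>

definition simple_weighted_graph :: "'a weighted_graph \<Rightarrow> bool" where
  "simple_weighted_graph G \<longleftrightarrow> finite (edges G) \<and>
     (\<forall>e\<in>edges G. \<exists>p q. e = {p, q} \<and> p \<in> verts G \<and> q \<in> verts G \<and> p \<noteq> q)"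

lemma simple_weighted_graph_edgeE:
  assumes "simple_weighted_graph G" "T \<subseteq> edges G" "e \<in> T"
  obtains p q where "e = {p, q}" "p \<in> verts G" "q \<in> verts G"
  using assms unfolding simple_weighted_graph_def by blast

lemma simple_weighted_graph_edgeD:
  assumes "simple_weighted_graph G" "{x, y} \<in> edges G"
  shows "x \<in> verts G" "y \<in> verts G" "x \<noteq> y"
  using assms by (force simp: simple_weighted_graph_def doubleton_eq_iff)+

text \<open>This form expresses spanning trees by reachability alone, so that exchanges need no
  bookkeeping of cycles.\<close>

lemma spanning_tree_iff_bridges:
  assumes "simple_weighted_graph G"
  shows "spanning_tree G T \<longleftrightarrow> T \<subseteq> edges G \<and> connected_on (verts G) T \<and>
    (\<forall>x y. {x, y} \<in> T \<longrightarrow> (x, y) \<notin> (adj (T - {{x, y}}))\<^sup>*)"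
proof (cases "T \<subseteq> edges G")
  case True
  have "{x} \<notin> T" for x
    using simple_weighted_graph_edgeD(3)[OF assms, of x x] True by auto
  from acyclic_iff_bridges[OF this] True show ?thesis
    unfolding spanning_tree_def by blast
qed (simp add: spanning_tree_def)

text \<open>Removing \<open>{u, v}\<close> separates the side of \<open>u\<close> from the side of
  \<open>v\<close>; since \<open>x\<close> lies on the first and \<open>y\<close> on the second,
  \<open>{x, y}\<close> joins them again and is a bridge.\<close>

lemma spanning_tree_exchange:
  assumes G: "simple_weighted_graph G" and T: "spanning_tree G T"
    and uv: "{u, v} \<in> T" and xy: "{x, y} \<in> edges G"
    and ux: "(u, x) \<in> (adj (T - {{u, v}}))\<^sup>*" and vy: "(v, y) \<in> (adj (T - {{u, v}}))\<^sup>*"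
  shows "spanning_tree G (insert {x, y} (T - {{u, v}}))" and "{x, y} \<notin> T - {{u, v}}"
proof -
  define F where "F = T - {{u, v}}"
  note T' = T[unfolded spanning_tree_iff_bridges[OF G]]
  have ux: "(u, x) \<in> (adj F)\<^sup>*" and vy: "(v, y) \<in> (adj F)\<^sup>*"
    using ux vy by (simp_all add: F_def)
  have "(u, v) \<notin> (adj F)\<^sup>*" using T' uv by (simp add: F_def)
  \<comment> \<open>Otherwise \<open>u\<close>, \<open>x\<close>, \<open>y\<close>, \<open>v\<close>
    would be joined in this order within \<open>F\<close>.\<close>
  then have xyF: "(x, y) \<notin> (adj F)\<^sup>*"
    using ux vy by (meson adj_rtrancl_sym rtrancl_trans)
  then show new: "{x, y} \<notin> T - {{u, v}}"
    unfolding F_def by (metis adj_iff r_into_rtrancl)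
  let ?T = "insert {x, y} F"
  have up: "(a, b) \<in> (adj F)\<^sup>* \<Longrightarrow> (a, b) \<in> (adj ?T)\<^sup>*" for a b
    by (rule adj_rtrancl_mono) auto
  have uvT: "(u, v) \<in> (adj ?T)\<^sup>*"
  proof -
    have "(u, x) \<in> (adj ?T)\<^sup>*" "(x, y) \<in> (adj ?T)\<^sup>*" "(y, v) \<in> (adj ?T)\<^sup>*"
      using up[OF ux] up[OF adj_rtrancl_sym[OF vy]] by (auto simp: adj_iff)
    then show ?thesis by (meson rtrancl_trans)
  qed
  have "adj T \<subseteq> (adj ?T)\<^sup>*"
  proof
    fix e assume "e \<in> adj T"
    then obtain a b where e: "e = (a, b)" "{a, b} \<in> T" by (auto simp: adj_def)
    consider "{a, b} \<in> F" | "a = u" "b = v" | "a = v" "b = u"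
      using e(2) by (auto simp: F_def doubleton_eq_iff)
    then show "e \<in> (adj ?T)\<^sup>*"
      using uvT adj_rtrancl_sym[OF uvT] e(1) by cases (auto simp: adj_iff)
  qed
  then have "(adj T)\<^sup>* \<subseteq> (adj ?T)\<^sup>*" by (metis rtrancl_mono rtrancl_idemp)
  then have "connected_on (verts G) ?T" using T' by (auto simp: connected_on_def)
  moreover have "(a, b) \<notin> (adj (?T - {{a, b}}))\<^sup>*" if ab: "{a, b} \<in> ?T" for a b
  proof
    assume c: "(a, b) \<in> (adj (?T - {{a, b}}))\<^sup>*"
    show False
    proof (cases "{a, b} = {x, y}")
      case True
      then have "(a, b) \<in> (adj F)\<^sup>*" using c by (auto elim!: adj_rtrancl_mono[rotated])
      then show False using xyF True by (auto simp: doubleton_eq_iff dest: adj_rtrancl_sym)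
    next
      case False
      then have abF: "{a, b} \<in> F" using ab by simp
      let ?F = "F - {{a, b}}"
      have "?T - {{a, b}} = insert {x, y} ?F" using False by auto
      then have c: "(a, b) \<in> (adj (insert {x, y} ?F))\<^sup>*" using c by simp
      have down: "(p, q) \<in> (adj ?F)\<^sup>* \<Longrightarrow> (p, q) \<in> (adj F)\<^sup>*" for p q
        by (rule adj_rtrancl_mono) auto
      have ab': "(a, b) \<in> (adj F)\<^sup>*" using abF by (auto simp: adj_iff)
      from c show False
      proof (cases rule: rtrancl_adj_insertE)
        case 1
        then have "(a, b) \<in> (adj (T - {{a, b}}))\<^sup>*"
          by (auto simp: F_def elim!: adj_rtrancl_mono[rotated])
        then show False using T' abF by (simp add: F_def)
      next
        \<comment> \<open>Bypassing \<open>{a, b}\<close> through the new edge would link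
          \<open>x\<close> to \<open>a\<close> and \<open>b\<close> to \<open>y\<close> in
          \<open>F\<close>; together with \<open>{a, b}\<close> itself this joins \<open>x\<close>
          to \<open>y\<close> in \<open>F\<close>. The next case is the mirror image.\<close>
        case 2
        then show False using xyF ab' down by (meson adj_rtrancl_sym rtrancl_trans)
      next
        case 3
        then show False using xyF ab' down by (meson adj_rtrancl_sym rtrancl_trans)
      qed
    qed
  qed
  moreover have "?T \<subseteq> edges G" using T' xy by (auto simp: F_def)
  ultimately show "spanning_tree G (insert {x, y} (T - {{u, v}}))"
    unfolding spanning_tree_iff_bridges[OF G] F_def by blast
qed

section \<open>The path criterion for minimality\<close>

text \<open>This is the cycle property: an edge of \<open>G\<close> outside the tree is a heaviest
  edge of the cycle that it closes with the tree.\<close>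

definition path_bounded :: "'a weighted_graph \<Rightarrow> 'a set set \<Rightarrow> bool" where
  "path_bounded G T \<longleftrightarrow> (\<forall>xs i. distinct_path T xs \<longrightarrow> {hd xs, last xs} \<in> edges G \<longrightarrow>
     Suc i < length xs \<longrightarrow> weight G {xs ! i, xs ! Suc i} \<le> weight G {hd xs, last xs})"

lemma sum_exchange:
  fixes w :: "'a \<Rightarrow> real"
  assumes "finite T" "e \<in> T" "f \<notin> T - {e}"
  shows "sum w (insert f (T - {e})) = sum w T - w e + w f"
  using assms by (simp add: sum_diff1)

lemma minimum_spanning_tree_path_bounded:
  assumes G: "simple_weighted_graph G" and T: "minimum_spanning_tree G T"
  shows "path_bounded G T"
  unfolding path_bounded_def
proof (intro allI impI)
  fix xs i
  assume xs: "distinct_path T xs" and e: "{hd xs, last xs} \<in> edges G" and i: "Suc i < length xs"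
  have st: "spanning_tree G T" using T by (simp add: minimum_spanning_tree_def)
  have fin: "finite T"
    using st G by (auto simp: spanning_tree_def simple_weighted_graph_def intro: finite_subset)
  let ?x = "xs ! i" and ?y = "xs ! Suc i"
  have ne: "xs \<noteq> []" using i by auto
  have f: "{?x, ?y} \<in> T" using xs i by (simp add: distinct_path_def)
  have other: "{xs ! k, xs ! Suc k} \<in> T - {{?x, ?y}}" if "Suc k < length xs" "k \<noteq> i" for k
    using that xs i distinct_path_edge_eqD[OF xs that(1) i] by (auto simp: distinct_path_def)
  have "(xs ! 0, ?x) \<in> (adj (T - {{?x, ?y}}))\<^sup>*"
    using i by (intro walk_rtrancl other) auto
  then have 1: "(?x, hd xs) \<in> (adj (T - {{?x, ?y}}))\<^sup>*"
    using ne by (simp add: hd_conv_nth adj_rtrancl_sym)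
  have "(?y, xs ! (length xs - 1)) \<in> (adj (T - {{?x, ?y}}))\<^sup>*"
    using i by (intro walk_rtrancl other) auto
  then have 2: "(?y, last xs) \<in> (adj (T - {{?x, ?y}}))\<^sup>*"
    using ne by (simp add: last_conv_nth)
  note ex = spanning_tree_exchange[OF G st f e 1 2]
  have "sum (weight G) T \<le> sum (weight G) (insert {hd xs, last xs} (T - {{?x, ?y}}))"
    using T ex(1) by (simp add: minimum_spanning_tree_def)
  also have "\<dots> = sum (weight G) T - weight G {?x, ?y} + weight G {hd xs, last xs}"
    by (rule sum_exchange[OF fin f ex(2)])
  finally show "weight G {?x, ?y} \<le> weight G {hd xs, last xs}" by simp
qed

lemma spanning_tree_subset_eq:
  assumes G: "simple_weighted_graph G" and "spanning_tree G T" "spanning_tree G S" "S \<subseteq> T"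
  shows "S = T"
proof (rule ccontr)
  note T = assms(2)[unfolded spanning_tree_iff_bridges[OF G]]
  assume "S \<noteq> T"
  then obtain e where e: "e \<in> T" "e \<notin> S" using assms(4) by auto
  then obtain x y where xy: "e = {x, y}" "x \<in> verts G" "y \<in> verts G"
    using simple_weighted_graph_edgeE[OF G, of T e] T by blast
  then have "(x, y) \<in> (adj S)\<^sup>*"
    using assms(3) by (auto simp: spanning_tree_def connected_on_def)
  then have "(x, y) \<in> (adj (T - {{x, y}}))\<^sup>*"
    by (rule adj_rtrancl_mono[rotated]) (use assms(4) e xy in auto)
  then show False using T e(1) xy(1) by blast
qed

lemma path_bounded_exchange:
  assumes G: "simple_weighted_graph G" and T: "spanning_tree G T" and pb: "path_bounded G T"
    and S: "spanning_tree G S" and e: "e \<in> S" "e \<notin> T"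
  obtains f where "f \<in> T" "f \<notin> S" "weight G f \<le> weight G e" "spanning_tree G (insert f (S - {e}))"
proof -
  note S' = S[unfolded spanning_tree_iff_bridges[OF G]]
  obtain u v where uv: "e = {u, v}" "u \<in> verts G" "v \<in> verts G"
    using simple_weighted_graph_edgeE[OF G, of S e] S' e(1) by blast
  then obtain xs where xs: "distinct_path T xs" "hd xs = u" "last xs = v"
    using T by (metis rtrancl_obtains_distinct_path spanning_tree_def connected_on_def)
  define n where "n = length xs - 1"
  have n: "length xs = Suc n" "xs ! 0 = u" "xs ! n = v"
    using xs by (auto simp: n_def distinct_path_def hd_conv_nth last_conv_nth)
  define R where "R = (adj (S - {e}))\<^sup>*"
  have uvR: "(u, v) \<notin> R" using S' e uv by (simp add: R_def)
  have "\<exists>i<n. (u, xs ! i) \<in> R \<and> (u, xs ! Suc i) \<notin> R"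
  proof (rule ccontr)
    assume c: "\<not> ?thesis"
    have "k \<le> n \<Longrightarrow> (u, xs ! k) \<in> R" for k
    proof (induction k)
      case 0
      show ?case by (simp add: n R_def)
    next
      case (Suc k)
      then show ?case using c by auto
    qed
    then show False using uvR n by auto
  qed
  then obtain i where i: "i < n" "(u, xs ! i) \<in> R" "(u, xs ! Suc i) \<notin> R" by blast
  let ?x = "xs ! i" and ?y = "xs ! Suc i"
  have f: "{?x, ?y} \<in> T" using xs(1) i n by (simp add: distinct_path_def)
  then have fG: "{?x, ?y} \<in> edges G" using T by (auto simp: spanning_tree_def)
  have "{?x, ?y} \<noteq> e" using f e by auto
  moreover have "{?x, ?y} \<notin> S - {e}"
    using i(2,3) unfolding R_def by (metis adj_iff rtrancl_into_rtrancl)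
  ultimately have fS: "{?x, ?y} \<notin> S" by auto
  have "?y \<in> verts G" using simple_weighted_graph_edgeD[OF G fG] by auto
  then have "(u, ?y) \<in> (adj (insert {u, v} (S - {e})))\<^sup>*"
    using S' uv e by (auto simp: connected_on_def insert_absorb)
  then have vy: "(v, ?y) \<in> R"
    using i(3) by (cases rule: rtrancl_adj_insertE) (auto simp: R_def)
  have "spanning_tree G (insert {?x, ?y} (S - {e}))"
    using spanning_tree_exchange(1)[OF G S _ fG, of u v] e(1) i(2) vy uv(1) by (simp add: R_def)
  moreover have "weight G {?x, ?y} \<le> weight G e"
  proof -
    have "{hd xs, last xs} \<in> edges G" using xs(2,3) e(1) uv(1) S' by blast
    moreover have "Suc i < length xs" using i(1) n(1) by simp
    ultimately have "weight G {?x, ?y} \<le> weight G {hd xs, last xs}"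
      using pb xs(1) by (simp add: path_bounded_def)
    then show ?thesis using xs(2,3) uv(1) by simp
  qed
  ultimately show ?thesis using f fS that by blast
qed

lemma path_bounded_minimum_spanning_tree:
  assumes G: "simple_weighted_graph G" and T: "spanning_tree G T" and pb: "path_bounded G T"
  shows "minimum_spanning_tree G T"
proof -
  have "sum (weight G) T \<le> sum (weight G) S" if "spanning_tree G S" for S
    using that
  proof (induction "card (S - T)" arbitrary: S rule: less_induct)
    case less
    have fin: "finite S"
      using less.prems G by (auto simp: spanning_tree_def simple_weighted_graph_def intro: finite_subset)
    show ?case
    proof (cases "S \<subseteq> T")
      case True
      then show ?thesis using spanning_tree_subset_eq[OF G T less.prems] by simp
    next
      case False
      then obtain e where e: "e \<in> S" "e \<notin> T" by blast
      then obtain f where f: "f \<in> T" "f \<notin> S" "weight G f \<le> weight G e"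
        "spanning_tree G (insert f (S - {e}))"
        using path_bounded_exchange[OF G T pb less.prems] by blast
      have "insert f (S - {e}) - T \<subset> S - T" using e f(1) by auto
      then have "card (insert f (S - {e}) - T) < card (S - T)"
        using fin by (intro psubset_card_mono) auto
      then have "sum (weight G) T \<le> sum (weight G) (insert f (S - {e}))"
        using less.hyps f(4) by blast
      also have "\<dots> = sum (weight G) S - weight G e + weight G f"
        using f(2) by (intro sum_exchange fin e(1)) simp
      finally show ?thesis using f(3) by simp
    qed
  qed
  then show ?thesis using T by (simp add: minimum_spanning_tree_def)
qed

lemma core_distance_le:
  assumes "finite P" "1 \<le> k" "k \<le> card {q \<in> P. dist p q \<le> M}"
  shows "core_distance k P p \<le> M"
proof (rule ccontr)
  define L where "L = sorted_list_of_multiset (image_mset (dist p) (mset_set P))"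
  assume "\<not> ?thesis"
  then have gt: "L ! (k - 1) > M" by (simp add: core_distance_def L_def)
  have "card {q \<in> P. dist p q \<le> M} = size (filter_mset (\<lambda>r. r \<le> M) (mset L))"
    using assms(1) by (simp add: L_def filter_mset_image_mset filter_mset_mset_set)
  also have "\<dots> = length (filter (\<lambda>r. r \<le> M) L)"
    by (metis mset_filter size_mset)
  also have "\<dots> = card {i. i < length L \<and> L ! i \<le> M}"
    by (rule length_filter_conv_card)
  also have "\<dots> \<le> card {..<k - 1}"
  proof (rule card_mono)
    have "i < k - 1" if "i < length L" "L ! i \<le> M" for i
    proof (rule ccontr)
      assume "\<not> i < k - 1"
      then have "L ! (k - 1) \<le> L ! i"
        using that by (intro sorted_nth_mono) (auto simp: L_def)
      then show False using gt that by simp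
    qed
    then show "{i. i < length L \<and> L ! i \<le> M} \<subseteq> {..<k - 1}" by auto
  qed simp
  finally show False using assms(2,3) by simp
qed

lemma simple_weighted_graph_complete_graph:
  assumes "finite P"
  shows "simple_weighted_graph (complete_graph P w)"
proof -
  have "{{p, q} | p q. p \<in> P \<and> q \<in> P \<and> p \<noteq> q} \<subseteq> Pow P" by auto
  then have "finite {{p, q} | p q. p \<in> P \<and> q \<in> P \<and> p \<noteq> q}"
    using assms by (auto intro: finite_subset)
  then show ?thesis by (auto simp: simple_weighted_graph_def complete_graph_def)
qed

lemma weight_complete_graph:
  "p \<noteq> q \<Longrightarrow> w q p = w p q \<Longrightarrow> weight (complete_graph P w) {p, q} = w p q"
  by (simp add: complete_graph_def edge_weight_doubleton)

theorem theoremD1: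
  fixes P :: "(real ^ 'd) set" and minPts :: nat and T :: "(real ^ 'd) set set"
  assumes "finite P"
    and "1 \<le> minPts" and "minPts \<le> 3"
    and "euclidean_mst P T"
  shows "minimum_spanning_tree (mutual_reachability_graph minPts P) T"
proof -
  let ?E = "complete_graph P dist" and ?M = "mutual_reachability_graph minPts P"
  let ?m = "mutual_reachability minPts P"
  have E: "simple_weighted_graph ?E" and M: "simple_weighted_graph ?M"
    using assms(1) by (simp_all add: mutual_reachability_graph_def simple_weighted_graph_complete_graph)
  have same: "edges ?M = edges ?E" "verts ?M = verts ?E"
    by (simp_all add: mutual_reachability_graph_def complete_graph_def)
  have mst: "minimum_spanning_tree ?E T" using assms(4) by (simp add: euclidean_mst_def)
  then have TE: "spanning_tree ?E T" by (simp add: minimum_spanning_tree_def)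
  then have TM: "spanning_tree ?M T" by (simp add: spanning_tree_def same)
  have wE: "weight ?E {p, q} = dist p q" if "p \<noteq> q" for p q
    using that by (simp add: weight_complete_graph dist_commute)
  have wM: "weight ?M {p, q} = ?m p q" if "p \<noteq> q" for p q
    using that by (simp add: mutual_reachability_graph_def weight_complete_graph mutual_reachability_commute)
  have "path_bounded ?M T"
    unfolding path_bounded_def
  proof (intro allI impI)
    fix xs i
    assume xs: "distinct_path T xs" and e: "{hd xs, last xs} \<in> edges ?M" and i: "Suc i < length xs"
    let ?u = "hd xs" and ?v = "last xs"
    have uv: "?u \<noteq> ?v" using simple_weighted_graph_edgeD[OF M e] by blast
    have edge: "xs ! k \<in> P" "xs ! Suc k \<in> P" "xs ! k \<noteq> xs ! Suc k" if "Suc k < length xs" for k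
    proof -
      have "{xs ! k, xs ! Suc k} \<in> edges ?E"
        using xs that TE by (auto simp: distinct_path_def spanning_tree_def)
      from simple_weighted_graph_edgeD[OF E this]
      show "xs ! k \<in> P" "xs ! Suc k \<in> P" "xs ! k \<noteq> xs ! Suc k"
        by (auto simp: complete_graph_def)
    qed
    have d: "dist (xs ! k) (xs ! Suc k) \<le> dist ?u ?v" if k: "Suc k < length xs" for k
      using minimum_spanning_tree_path_bounded[OF E mst] xs e k edge(3)[OF k] uv
      by (metis path_bounded_def same(1) wE)
    have le: "core_distance minPts P ?u \<le> ?m ?u ?v" "core_distance minPts P ?v \<le> ?m ?u ?v"
      "dist ?u ?v \<le> ?m ?u ?v"
      by (simp_all add: mutual_reachability_def)
    have cd: "core_distance minPts P (xs ! k) \<le> ?m ?u ?v" if k: "k < length xs" for k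
    proof -
      consider "k = 0" | "Suc k = length xs" | j where "k = Suc j" "Suc (Suc j) < length xs"
        using Suc_lessI[OF k] by (cases k) auto
      then show ?thesis
      proof cases
        case 1
        then show ?thesis using le k by (simp add: hd_conv_nth)
      next
        case 2
        then have "xs ! k = ?v" by (metis diff_Suc_1 last_conv_nth list.size(3) nat.distinct(1))
        then show ?thesis using le by simp
      next
        case 3
        let ?A = "{xs ! j, xs ! Suc j, xs ! Suc (Suc j)}"
        have "card ?A = 3"
          using xs 3(2) by (auto simp: distinct_path_def nth_eq_iff_index_eq)
        moreover have "?A \<subseteq> {q \<in> P. dist (xs ! k) q \<le> dist ?u ?v}"
          using edge[of j] edge[of "Suc j"] d[of j] d[of "Suc j"] 3 by (auto simp: dist_commute)
        then have "card ?A \<le> card {q \<in> P. dist (xs ! k) q \<le> dist ?u ?v}"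
          using assms(1) by (intro card_mono) auto
        ultimately have "core_distance minPts P (xs ! k) \<le> dist ?u ?v"
          using assms by (intro core_distance_le) auto
        then show ?thesis using le by simp
      qed
    qed
    have "?m (xs ! i) (xs ! Suc i) \<le> ?m ?u ?v"
      using cd[of i] cd[OF i] d[OF i] le(3) i
      unfolding mutual_reachability_def[of _ _ "xs ! i"] by simp
    then show "weight ?M {xs ! i, xs ! Suc i} \<le> weight ?M {?u, ?v}"
      using wM edge(3)[OF i] uv by simp
  qed
  with M TM show ?thesis by (rule path_bounded_minimum_spanning_tree)
qed

end
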